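(* Let $n\ge2$ and $p=\left[\frac{n-1}{2}\right]$. Let $\mathcal{Q}$ be an austere subspace in $M(n,\mathbb{R})$ such that $\mathcal{Q}\cap\mathcal{B}_{n,\mathbb{R}}\neq\varnothing$. Then $$\dim\mathcal{Q}\le\begin{cases}p^2+2p & \text{if } n=2p+1;\\ p^2+3p+2 & \text{if } n=2p+2.\end{cases}$$
   Context: An $n\times n$ real symmetric matrix $A$ is austere if $\operatorname{tr}A^{2k+1}=0$ for each $0\le k\le\left[\frac{n-1}{2}\right]$ (equivalently, all symmetric polynomials of odd degree in its eigenvalues vanish). An austere subspace is a linear subspace of the space of $n\times n$ real symmetric matrices consisting of austere matrices. $E(n,\mathbb{R})$ is the space of traceless $n\times n$ real symmetric matrices with inner product $\langle A,B\rangle=\operatorname{tr}(AB^t)$, and $S(n,\mathbb{R})$ is its unit sphere. Define $\Phi_{n,\mathbb{R}}:S(n,\mathbb{R})\to\mathbb{R}^p$, $A\mapsto(\operatorname{tr}A^3,\operatorname{tr}A^5,\dots,\operatorname{tr}A^{2p+1})$. $\mathcal{B}_{n,\mathbb{R}}$ is the set of regular points of $\Phi_{n,\mathbb{R}}$ (points where the differential is surjective) lying in $\Phi_{n,\mathbb{R}}^{-1}(0)$. (When $n=2$, $p=0$ and every point is regular.) *)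

theory Defs
  imports "HOL-Analysis.Analysis"
begin

(* The exponent operator of type class power would act entrywise, so powers with
   respect to the matrix product need their own definition. *)
primrec mat_power :: "real^'n^'n \<Rightarrow> nat \<Rightarrow> real^'n^'n" where
  "mat_power A 0 = mat 1"
| "mat_power A (Suc k) = A ** mat_power A k"

definition symmetric_mat :: "real^'n^'n \<Rightarrow> bool" where
  "symmetric_mat A \<longleftrightarrow> transpose A = A"

definition austere :: "real^'n^'n \<Rightarrow> bool" where
  "austere A \<longleftrightarrow> symmetric_mat A \<and>
     (\<forall>k. k \<le> (CARD('n) - 1) div 2 \<longrightarrow> trace (mat_power A (2 * k + 1)) = 0)"

definition austere_subspace :: "(real^'n^'n) set \<Rightarrow> bool" where
  "austere_subspace Q \<longleftrightarrow> subspace Q \<and> (\<forall>A\<in>Q. austere A)"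

definition E_space :: "(real^'n^'n) set" where
  "E_space = {A. symmetric_mat A \<and> trace A = 0}"

definition S_sphere :: "(real^'n^'n) set" where
  "S_sphere = {A \<in> E_space. trace (A ** transpose A) = 1}"

(* R^p may have p = 0 and p depends on n, so its points are represented as functions on the
   index set {1..p} that are undefined elsewhere (extensional functions). *)
definition R_pow :: "nat \<Rightarrow> (nat \<Rightarrow> real) set" where
  "R_pow p = ({1..p} \<rightarrow>\<^sub>E UNIV)"

(* The formula for Phi makes sense for every matrix; Phi proper is its restriction to S_sphere. *)
definition Phi :: "real^'n^'n \<Rightarrow> nat \<Rightarrow> real" where
  "Phi A = (\<lambda>k\<in>{1..(CARD('n) - 1) div 2}. trace (mat_power A (2 * k + 1)))"

(* The tangent space to an embedded submanifold M at A: all velocities of curves in M through A. *)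
definition tangent_space :: "'a::real_normed_vector set \<Rightarrow> 'a \<Rightarrow> 'a set" where
  "tangent_space M A = {X. \<exists>\<gamma>::real \<Rightarrow> 'a. range \<gamma> \<subseteq> M \<and> \<gamma> 0 = A \<and>
     (\<gamma> has_vector_derivative X) (at 0)}"

(* The differential of Phi on S_sphere at A is the restriction to the tangent space of the
   Frechet derivative, taken componentwise, of the polynomial formula on the ambient space. *)
definition dPhi :: "real^'n^'n \<Rightarrow> real^'n^'n \<Rightarrow> nat \<Rightarrow> real" where
  "dPhi A X = (\<lambda>k\<in>{1..(CARD('n) - 1) div 2}. frechet_derivative (\<lambda>B. Phi B k) (at A) X)"

definition regular_point :: "real^'n^'n \<Rightarrow> bool" where
  "regular_point A \<longleftrightarrow> A \<in> S_sphere \<and>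
     dPhi A ` tangent_space S_sphere A = R_pow ((CARD('n) - 1) div 2)"

definition B_set :: "(real^'n^'n) set" where
  "B_set = {A \<in> S_sphere. regular_point A \<and> (\<forall>k\<in>{1..(CARD('n) - 1) div 2}. Phi A k = 0)}"

end

theory Submission
  imports Defs "HOL-Computational_Algebra.Polynomial_FPS"
begin

text \<open>
  Let \<open>A\<close> be a regular point in \<open>Q\<close>, with eigenvalues \<open>d\<^sub>i\<close>. The odd power sums of the \<open>d\<^sub>i\<close> of
  exponent at most \<open>n\<close> vanish, so by Newton's identities the spectrum is symmetric about zero
  (\<open>odd_power_sums_zero_imp_symmetric\<close>). Regularity says that \<open>1, A\<^sup>2, \<dots>, A\<^bsup>2p\<^esup>\<close> are linearly
  independent, hence that there are at least \<open>p + 1\<close> different squares \<open>d\<^sub>i\<^sup>2\<close>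
  (\<open>regular_point_card_squares\<close>). As \<open>n \<le> 2p + 2\<close>, it follows that there are exactly \<open>p + 1\<close>
  squares, each with at most two indices (\<open>symmetric_spectrum_fibers\<close>).

  Now pass to an orthonormal eigenbasis of \<open>A\<close>, and let \<open>X\<close> be in \<open>Q\<close>. The polynomials
  \<open>tr (A + t X)\<^bsup>2k+1\<^esup>\<close> in \<open>t\<close> are zero for \<open>k \<le> p\<close>. Their linear coefficients yield
  \<open>\<Sum>\<^sub>i d\<^sub>i\<^bsup>2k\<^esup> X\<^sub>i\<^sub>i = 0\<close>, so the diagonal entries of \<open>X\<close> over each square sum to zero. If
  \<open>p \<ge> 1\<close>, the quadratic coefficient for \<open>k = 1\<close> yields \<open>tr (A X\<^sup>2) = 0\<close>, that is
  \<open>\<Sum>\<^sub>i\<^sub>j (d\<^sub>i + d\<^sub>j) X\<^sub>i\<^sub>j\<^sup>2 = 0\<close>. Hence \<open>Q\<close>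
  is isotropic for an indefinite quadratic form and meets any subspace on which the form is definite
  only in zero. In terms of entries, a matrix in \<open>Q\<close> is determined by its entries on and above the
  diagonal after leaving out one diagonal entry per square and all places with \<open>d\<^sub>i + d\<^sub>j > 0\<close>, or
  alternatively all places with \<open>d\<^sub>i + d\<^sub>j < 0\<close>. There are at most \<open>n - (p + 1)\<close> places above the
  diagonal with \<open>d\<^sub>i + d\<^sub>j = 0\<close>, so leaving out the larger of the two families saves about half of the
  entries above the diagonal; the count (\<open>dim_bound_diagonal\<close>) is the asserted bound in both
  parities. For \<open>p = 0\<close> it follows from the vanishing of the trace alone.
\<close>

\<comment> \<open>The dollar sign is reserved for entries of vectors and matrices.\<close>
unbundle no fps_syntax

section \<open>Orthogonal diagonalization of symmetric matrices\<close>

text \<open>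
  A maximiser \<open>v\<close> of the Rayleigh quotient on the unit sphere of \<open>S\<close> is an eigenvector: otherwise
  the vector \<open>f v - c v\<close>, where \<open>c\<close> is the maximal value, is a direction in which the quotient
  still increases to first order.
\<close>
lemma selfadjoint_unit_eigenvector:
  fixes f :: "'a::euclidean_space \<Rightarrow> 'a"
  assumes lin: "linear f" and S: "subspace S" "S \<noteq> {0}"
    and inv: "\<And>x. x \<in> S \<Longrightarrow> f x \<in> S"
    and adj: "\<And>x y. f x \<bullet> y = x \<bullet> f y"
  obtains v c where "v \<in> S" "norm v = 1" "f v = c *\<^sub>R v"
proof -
  interpret f: linear f by (fact lin)
  have comp: "compact (sphere 0 1 \<inter> S)"
    using S(1) by (simp add: compact_Int_closed closed_subspace)
  obtain u where u: "u \<in> S" "u \<noteq> 0"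
    using S subspace_0 by blast
  have "u /\<^sub>R norm u \<in> sphere 0 1 \<inter> S"
    using u S(1) by (simp add: subspace_scale)
  then have ne: "sphere 0 1 \<inter> S \<noteq> {}" by blast
  have cont: "continuous_on (sphere 0 1 \<inter> S) (\<lambda>x. x \<bullet> f x)"
    by (intro continuous_intros linear_continuous_on linear_conv_bounded_linear[THEN iffD1] lin)
  obtain v where v: "norm v = 1" "v \<in> S"
    and vmax: "\<And>y. norm y = 1 \<Longrightarrow> y \<in> S \<Longrightarrow> y \<bullet> f y \<le> v \<bullet> f v"
    using continuous_attains_sup[OF comp ne cont] by auto
  define c where "c = v \<bullet> f v"
  have bound: "y \<bullet> f y \<le> c * (y \<bullet> y)" if "y \<in> S" for y
  proof (cases "y = 0")
    case False
    have "(y /\<^sub>R norm y) \<bullet> f (y /\<^sub>R norm y) \<le> c"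
      unfolding c_def using False that S(1) by (intro vmax) (auto simp: subspace_scale)
    then have "(y \<bullet> f y) / (norm y)\<^sup>2 \<le> c"
      by (simp add: f.scaleR field_simps power2_eq_square)
    then show ?thesis
      using False by (simp add: divide_le_eq dot_square_norm)
  qed (simp add: f.zero)
  define w where "w = c *\<^sub>R v - f v"
  have wS: "w \<in> S" unfolding w_def using S(1) v inv by (simp add: subspace_diff subspace_scale)
  define b where "b = c * (w \<bullet> w) - w \<bullet> f w"
  have vv: "v \<bullet> v = 1" using v by (simp add: dot_square_norm)
  have quad: "0 \<le> 2 * t * (w \<bullet> w) + t\<^sup>2 * b" for t
  proof -
    have "v + t *\<^sub>R w \<in> S" using v wS S(1) by (simp add: subspace_add subspace_scale)
    from bound[OF this]
    have *: "0 \<le> c * ((v + t *\<^sub>R w) \<bullet> (v + t *\<^sub>R w)) - (v + t *\<^sub>R w) \<bullet> f (v + t *\<^sub>R w)"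
      by simp
    have ww: "c * (v \<bullet> w) = w \<bullet> w + f v \<bullet> w"
      by (simp add: w_def inner_diff_left)
    have sym: "v \<bullet> f w = f v \<bullet> w" "w \<bullet> f v = f v \<bullet> w"
      by (simp_all only: adj inner_commute[of w "f v"])
    have "c * ((v + t *\<^sub>R w) \<bullet> (v + t *\<^sub>R w)) = c + 2 * t * (c * (v \<bullet> w)) + t\<^sup>2 * (c * (w \<bullet> w))"
      by (simp add: inner_add_left inner_add_right vv inner_commute[of w v] algebra_simps power2_eq_square)
    moreover have "(v + t *\<^sub>R w) \<bullet> f (v + t *\<^sub>R w) = c + 2 * t * (f v \<bullet> w) + t\<^sup>2 * (w \<bullet> f w)"
      by (simp add: f.add f.scaleR inner_add_left inner_add_right c_def[symmetric] sym algebra_simps power2_eq_square)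
    ultimately show ?thesis
      using * unfolding ww b_def by (simp add: algebra_simps)
  qed
  have "w \<bullet> w = 0"
  proof (rule ccontr)
    assume "w \<bullet> w \<noteq> 0"
    then have pos: "w \<bullet> w > 0" by simp
    \<comment> \<open>A small step in the direction \<open>- w\<close>, short enough for the linear term to dominate.\<close>
    define t where "t = (w \<bullet> w) / (\<bar>b\<bar> + 1)"
    have t: "t > 0" "t * (\<bar>b\<bar> + 1) = w \<bullet> w" unfolding t_def using pos by simp_all
    have "0 \<le> t * (t * b - 2 * (w \<bullet> w))"
      using quad[of "- t"] by (simp add: power2_eq_square algebra_simps)
    then have "2 * (w \<bullet> w) \<le> t * b" using t(1) by (simp add: zero_le_mult_iff)
    moreover have "t * b \<le> t * (\<bar>b\<bar> + 1)" using t(1) by (intro mult_left_mono) auto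
    ultimately show False using pos t(2) by simp
  qed
  then have "f v = c *\<^sub>R v" unfolding w_def by simp
  with v show ?thesis using that by blast
qed

text \<open>
  Induction on the dimension: the orthogonal complement in \<open>S\<close> of a unit eigenvector is again
  invariant, because the map is self-adjoint.
\<close>
lemma selfadjoint_orthonormal_eigenbasis:
  fixes f :: "'a::euclidean_space \<Rightarrow> 'a"
  assumes lin: "linear f" and adj: "\<And>x y. f x \<bullet> y = x \<bullet> f y"
    and "subspace S" "\<And>x. x \<in> S \<Longrightarrow> f x \<in> S"
  shows "\<exists>B. span B = S \<and> pairwise orthogonal B \<and> (\<forall>v\<in>B. norm v = 1 \<and> (\<exists>c. f v = c *\<^sub>R v))"
  using assms(3,4)
proof (induction "dim S" arbitrary: S rule: less_induct)
  case less
  show ?case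
  proof (cases "S = {0}")
    case True
    then show ?thesis by (intro exI[of _ "{}"]) auto
  next
    case False
    obtain v c where v: "v \<in> S" "norm v = 1" "f v = c *\<^sub>R v"
      using selfadjoint_unit_eigenvector[OF lin less.prems(1) False less.prems(2) adj] by metis
    define T where "T = {y \<in> S. orthogonal v y}"
    have T: "subspace T"
      using less.prems(1) unfolding T_def subspace_def by (auto simp: orthogonal_clauses)
    have vT: "v \<notin> T" using v by (auto simp: T_def orthogonal_self)
    have "T \<subset> S" using vT v(1) by (auto simp: T_def)
    then have "dim T < dim S"
      using T less.prems(1) by (metis dim_psubset span_eq_iff)
    moreover have "f x \<in> T" if "x \<in> T" for x
      using that less.prems(2) v(3) adj[of v x, symmetric] by (simp add: T_def orthogonal_def)
    ultimately obtain B where B: "span B = T" "pairwise orthogonal B"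
      "\<forall>v\<in>B. norm v = 1 \<and> (\<exists>c. f v = c *\<^sub>R v)"
      using less.hyps[of T] T by blast
    have "B \<subseteq> T" using B(1) span_superset by blast
    have "pairwise orthogonal (insert v B)"
      using B(2) \<open>B \<subseteq> T\<close> by (auto simp: pairwise_insert T_def orthogonal_commute)
    moreover have "span (insert v B) = S"
    proof
      show "span (insert v B) \<subseteq> S"
        using v(1) \<open>B \<subseteq> T\<close> less.prems(1) by (intro span_minimal) (auto simp: T_def)
      show "S \<subseteq> span (insert v B)"
      proof
        fix x assume x: "x \<in> S"
        have "x - (v \<bullet> x) *\<^sub>R v \<in> T"
          using x v less.prems(1)
          by (auto simp: T_def orthogonal_def inner_diff_right dot_square_norm subspace_diff subspace_scale)
        then show "x \<in> span (insert v B)"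
          unfolding span_insert B(1) by blast
      qed
    qed
    ultimately show ?thesis using B(3) v by (intro exI[of _ "insert v B"]) auto
  qed
qed

lemma symmetric_matrix_diagonalization:
  fixes A :: "real^'n^'n"
  assumes "transpose A = A"
  obtains P d where "orthogonal_matrix P"
    "transpose P ** A ** P = (\<chi> i j. if i = j then d i else 0)"
proof -
  have adj: "(A *v x) \<bullet> y = x \<bullet> (A *v y)" for x y
    by (metis assms dot_lmul_matrix transpose_matrix_vector)
  obtain B where B: "span B = UNIV" "pairwise orthogonal B"
    and B1: "\<forall>v\<in>B. norm v = 1 \<and> (\<exists>c. A *v v = c *\<^sub>R v)"
    using selfadjoint_orthonormal_eigenbasis[OF _ adj subspace_UNIV] by auto
  have "independent B"
    using B(2) B1 by (intro pairwise_orthogonal_independent) auto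
  then have "card B = CARD('n)" "finite B"
    using B(1) by (auto simp: dim_span_eq_card_independent[symmetric] independent_imp_finite)
  then obtain b :: "'n \<Rightarrow> real^'n" where b: "bij_betw b UNIV B"
    using finite_same_card_bij[of "UNIV :: 'n set" B] by auto
  have bB: "b i \<in> B" for i using b by (auto simp: bij_betw_def)
  have orth: "b i \<bullet> b j = (if i = j then 1 else 0)" for i j
  proof (cases "i = j")
    case True
    then show ?thesis using B1 bB by (simp add: dot_square_norm)
  next
    case False
    then have "b i \<noteq> b j" using b by (auto simp: bij_betw_def inj_on_def)
    then show ?thesis using B(2) bB False by (auto simp: pairwise_def orthogonal_def)
  qed
  have "\<forall>i. \<exists>c. A *v b i = c *\<^sub>R b i" using B1 bB by blast
  then obtain d where d: "\<And>i. A *v b i = d i *\<^sub>R b i" by (auto simp: choice_iff)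
  define P :: "real^'n^'n" where "P = (\<chi> i j. b j $ i)"
  have "transpose P ** P = mat 1"
    using orth by (simp add: P_def vec_eq_iff matrix_matrix_mult_def transpose_def mat_def inner_vec_def)
  then have "orthogonal_matrix P" by (simp add: orthogonal_matrix)
  moreover have "transpose P ** A ** P = (\<chi> i j. if i = j then d i else 0)"
  proof -
    have "(transpose P ** (A ** P)) $ i $ j = b i \<bullet> (A *v b j)" for i j
      by (simp add: P_def matrix_matrix_mult_def transpose_def inner_vec_def matrix_vector_mult_def)
    then show ?thesis
      using orth by (simp add: vec_eq_iff matrix_mul_assoc[symmetric] d)
  qed
  ultimately show ?thesis using that by blast
qed

section \<open>Power sums and symmetric spectra\<close>

text \<open>
  Newton's identities in generating function form: the logarithmic derivative of
  \<open>\<Prod>(1 - c\<^sub>i X)\<close> is \<open>- \<Sum> c\<^sub>i / (1 - c\<^sub>i X)\<close>, whose coefficients are the negated power sums.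
\<close>
lemma fps_deriv_prod_linear:
  fixes c :: "'i \<Rightarrow> real"
  assumes "finite I"
  shows "fps_deriv (\<Prod>i\<in>I. 1 - fps_const (c i) * fps_X)
    = - (\<Prod>i\<in>I. 1 - fps_const (c i) * fps_X) * Abs_fps (\<lambda>k. \<Sum>i\<in>I. c i ^ Suc k)"
  using assms
proof (induction I rule: finite_induct)
  case empty
  then show ?case by (simp add: fps_eq_iff)
next
  case (insert j I)
  define F where "F = (\<Prod>i\<in>I. 1 - fps_const (c i) * fps_X)"
  define G where "G = Abs_fps (\<lambda>k. \<Sum>i\<in>I. c i ^ Suc k)"
  define H where "H = Abs_fps (\<lambda>k. c j ^ Suc k)"
  have "fps_const (c j) * fps_X * H + fps_const (c j) = H"
    by (rule fps_ext) (auto simp: H_def mult.assoc power_eq_if)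
  then have H: "(1 - fps_const (c j) * fps_X) * H = fps_const (c j)"
    by (simp add: algebra_simps)
  have "Abs_fps (\<lambda>k. \<Sum>i\<in>insert j I. c i ^ Suc k) = H + G"
    using insert.hyps by (simp add: fps_eq_iff H_def G_def)
  moreover have "fps_deriv F = - F * G" using insert.IH unfolding F_def G_def .
  ultimately have "- ((1 - fps_const (c j) * fps_X) * F) * Abs_fps (\<lambda>k. \<Sum>i\<in>insert j I. c i ^ Suc k)
      = - (((1 - fps_const (c j) * fps_X) * H) * F) + (1 - fps_const (c j) * fps_X) * fps_deriv F"
    by (simp add: algebra_simps)
  also have "\<dots> = fps_deriv ((1 - fps_const (c j) * fps_X) * F)"
    unfolding H by (simp add: fps_const_neg[symmetric] del: fps_const_neg)
  finally show ?case using insert.hyps unfolding F_def by simp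
qed

text \<open>
  Read coefficientwise, the preceding identity determines the coefficients of the product one after
  the other from the power sums, and the product has degree at most \<open>card I\<close>.
\<close>
lemma prod_linear_eq_of_power_sums_eq:
  fixes c e :: "'i \<Rightarrow> real"
  assumes I: "finite I"
    and ps: "\<And>k. 1 \<le> k \<Longrightarrow> k \<le> card I \<Longrightarrow> (\<Sum>i\<in>I. c i ^ k) = (\<Sum>i\<in>I. e i ^ k)"
  shows "(\<Prod>i\<in>I. [:1, - c i:]) = (\<Prod>i\<in>I. [:1, - e i:])"
proof -
  define F where "F = (\<lambda>c::'i\<Rightarrow>real. \<Prod>i\<in>I. [:1, - c i:])"
  have fps: "fps_of_poly (F c) = (\<Prod>i\<in>I. 1 - fps_const (c i) * fps_X)" for c
    by (simp add: F_def fps_of_poly_prod fps_of_poly_pCons fps_const_neg[symmetric] del: fps_const_neg)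
  have rec: "real (Suc k) * coeff (F c) (Suc k)
      = - (\<Sum>i=0..k. coeff (F c) i * (\<Sum>l\<in>I. c l ^ Suc (k - i)))" for c k
    using arg_cong[OF fps_deriv_prod_linear[OF I, of c], where f="\<lambda>f. fps_nth f k"]
    by (simp add: fps[symmetric] fps_mult_nth sum_negf)
  have deg: "degree (F c) \<le> card I" for c
  proof -
    have "degree (F c) \<le> sum (degree \<circ> (\<lambda>i. [:1, - c i:])) I"
      unfolding F_def by (rule degree_prod_sum_le[OF I])
    also have "\<dots> \<le> (\<Sum>i\<in>I. 1)" by (intro sum_mono) auto
    finally show ?thesis by simp
  qed
  have c0: "coeff (F c) 0 = 1" for c
    by (simp add: F_def poly_0_coeff_0[symmetric] poly_prod)
  have "coeff (F c) k = coeff (F e) k" if "k \<le> card I" for k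
    using that
  proof (induction k rule: less_induct)
    case (less k)
    show ?case
    proof (cases k)
      case (Suc m)
      have "(\<Sum>i=0..m. coeff (F c) i * (\<Sum>l\<in>I. c l ^ Suc (m - i)))
          = (\<Sum>i=0..m. coeff (F e) i * (\<Sum>l\<in>I. e l ^ Suc (m - i)))"
        using less Suc by (intro sum.cong refl arg_cong2[where f="(*)"] ps) auto
      then have "real (Suc m) * coeff (F c) (Suc m) = real (Suc m) * coeff (F e) (Suc m)"
        by (simp only: rec)
      then show ?thesis using Suc by (simp del: of_nat_Suc)
    qed (simp add: c0)
  qed
  moreover have "coeff (F c) k = coeff (F e) k" if "k > card I" for k
    using that deg[of c] deg[of e] by (simp add: coeff_eq_0)
  ultimately have "F c = F e" by (metis poly_eqI not_le)
  then show ?thesis by (simp add: F_def)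
qed

text \<open>
  The factor of index \<open>i\<close> has its root at \<open>1 / c\<^sub>i\<close>; indices with \<open>c\<^sub>i = 0\<close> leave no trace in the
  product, hence the restriction on \<open>x\<close>.
\<close>
lemma order_prod_linear:
  fixes c :: "'i \<Rightarrow> real"
  assumes "finite I" "x \<noteq> 0"
  shows "order (1 / x) (\<Prod>i\<in>I. [:1, - c i:]) = card {i\<in>I. c i = x}"
  using assms(1)
proof (induction I rule: finite_induct)
  case (insert j I)
  have ord: "order (1 / x) [:1, - c j:] = (if c j = x then 1 else 0)"
  proof (cases "c j = x")
    case True
    have "[:1, - c j:] = smult (- x) [:- (1 / x), 1:]" using True assms(2) by simp
    then have "order (1 / x) [:1, - c j:] = order (1 / x) [:- (1 / x), 1:]"
      using assms(2) by (simp only: order_smult)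
    also have "\<dots> = 1" using order_power_n_n[of "1/x" 1] by simp
    finally show ?thesis using True by simp
  next
    case False
    then show ?thesis using assms(2) by (auto intro!: order_0I simp: field_simps)
  qed
  have "{i \<in> insert j I. c i = x} = (if c j = x then insert j {i\<in>I. c i = x} else {i\<in>I. c i = x})"
    by auto
  moreover have "order (1 / x) ([:1, - c j:] * (\<Prod>i\<in>I. [:1, - c i:]))
      = order (1 / x) [:1, - c j:] + order (1 / x) (\<Prod>i\<in>I. [:1, - c i:])"
    using insert.hyps by (intro order_mult no_zero_divisors) auto
  ultimately show ?case
    using insert ord by (simp del: mult_pCons_left)
qed (simp add: order_1_eq_0)

text \<open>
  The families \<open>d\<close> and \<open>- d\<close> have the same even power sums always, and the same odd ones because
  these vanish.
\<close>
lemma odd_power_sums_zero_imp_symmetric: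
  fixes d :: "'i \<Rightarrow> real"
  assumes I: "finite I"
    and odd0: "\<And>k. odd k \<Longrightarrow> k \<le> card I \<Longrightarrow> (\<Sum>i\<in>I. d i ^ k) = 0"
    and x: "x \<noteq> 0"
  shows "card {i\<in>I. d i = x} = card {i\<in>I. d i = - x}"
proof -
  have "(\<Prod>i\<in>I. [:1, - d i:]) = (\<Prod>i\<in>I. [:1, - (- d i):])"
  proof (rule prod_linear_eq_of_power_sums_eq[OF I])
    fix k assume "k \<le> card I"
    then show "(\<Sum>i\<in>I. d i ^ k) = (\<Sum>i\<in>I. (- d i) ^ k)"
      using odd0[of k] by (cases "odd k") (auto simp: sum_negf)
  qed
  then have "card {i\<in>I. d i = x} = card {i\<in>I. - d i = x}"
    using order_prod_linear[OF I x, of d] order_prod_linear[OF I x, of "\<lambda>i. - d i"] by simp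
  moreover have "{i\<in>I. - d i = x} = {i\<in>I. d i = - x}" by auto
  ultimately show ?thesis by simp
qed

section \<open>First and second order conditions from traces of powers\<close>

lemma matrix_add_rdistrib:
  fixes A B :: "'a::semiring_1^'n^'m"
  shows "(A + B) ** C = A ** C + B ** C"
  by (vector matrix_matrix_mult_def sum.distrib[symmetric] distrib_right)

lemma bounded_bilinear_matrix_mult:
  "bounded_bilinear ((**) :: real^'n^'n \<Rightarrow> real^'n^'n \<Rightarrow> real^'n^'n)"
proof -
  have "bilinear ((**) :: real^'n^'n \<Rightarrow> real^'n^'n \<Rightarrow> real^'n^'n)"
    unfolding bilinear_def
    by (intro conjI allI linearI)
      (simp_all add: matrix_add_ldistrib matrix_add_rdistrib scalar_matrix_assoc matrix_scalar_ac)
  then show ?thesis by (simp add: bilinear_conv_bounded_bilinear)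
qed

lemma linear_trace: "linear (trace :: real^'n^'n \<Rightarrow> real)"
  by (intro linearI) (simp_all add: trace_def sum.distrib sum_distrib_left)

lemma mat_power_commute_left: "A ** C = C ** A \<Longrightarrow> mat_power A k ** C = C ** mat_power A k"
  by (induction k) (simp_all add: matrix_mul_assoc, metis matrix_mul_assoc)

text \<open>
  The derivative of the matrix power in direction \<open>X\<close> is the sum of the \<open>A\<^sup>i X A\<^sup>j\<close> with
  \<open>i + j = m - 1\<close>. Its summands become equal under the trace, also after multiplication by a matrix
  \<open>C\<close> that commutes with \<open>A\<close>; the factor \<open>C\<close> is what lets the induction go through.
\<close>
lemma mat_power_has_derivative:
  fixes A :: "real^'n^'n"
  shows "\<exists>D. ((\<lambda>B. mat_power B m) has_derivative D) (at A) \<and>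
    (\<forall>X C. A ** C = C ** A \<longrightarrow> trace (D X ** C) = real m * trace (mat_power A (m - 1) ** C ** X))"
proof (induction m)
  case 0
  have "((\<lambda>B. mat_power B 0 :: real^'n^'n) has_derivative (\<lambda>X. 0)) (at A)" by simp
  then show ?case by (intro exI[of _ "\<lambda>X. 0"]) (simp add: trace_0[simplified])
next
  case (Suc m)
  then obtain D where D: "((\<lambda>B. mat_power B m) has_derivative D) (at A)"
    and tr: "\<And>X C. A ** C = C ** A \<Longrightarrow> trace (D X ** C) = real m * trace (mat_power A (m - 1) ** C ** X)"
    by blast
  have "((\<lambda>B. B ** mat_power B m) has_derivative (\<lambda>X. A ** D X + X ** mat_power A m)) (at A)"
    by (rule bounded_bilinear.FDERIV[OF bounded_bilinear_matrix_mult has_derivative_ident D])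
  moreover have "trace ((A ** D X + X ** mat_power A m) ** C)
      = real (Suc m) * trace (mat_power A m ** C ** X)" if C: "A ** C = C ** A" for X C
  proof -
    have "trace (A ** D X ** C) = trace (D X ** (C ** A))"
      by (metis trace_mul_sym matrix_mul_assoc)
    also have "\<dots> = real m * trace (mat_power A (m - 1) ** (C ** A) ** X)"
      by (rule tr) (metis C matrix_mul_assoc)
    also have "\<dots> = real m * trace (mat_power A m ** C ** X)"
    proof (cases m)
      case (Suc l)
      have "mat_power A l ** (C ** A) = A ** mat_power A l ** C"
        using mat_power_commute_left[of A A l] C by (metis matrix_mul_assoc)
      then show ?thesis using Suc by simp
    qed simp
    finally have "trace (A ** D X ** C) = real m * trace (mat_power A m ** C ** X)" .
    moreover have "trace (X ** mat_power A m ** C) = trace (mat_power A m ** C ** X)"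
      by (metis trace_mul_sym matrix_mul_assoc)
    ultimately show ?thesis
      by (simp add: matrix_add_rdistrib trace_add algebra_simps)
  qed
  ultimately show ?case
    by (intro exI[of _ "\<lambda>X. A ** D X + X ** mat_power A m"]) simp
qed

lemma trace_mat_power_has_derivative:
  fixes A :: "real^'n^'n"
  shows "((\<lambda>B. trace (mat_power B m)) has_derivative
    (\<lambda>X. real m * trace (mat_power A (m - 1) ** X))) (at A)"
proof -
  obtain D where D: "((\<lambda>B. mat_power B m) has_derivative D) (at A)"
    and tr: "\<And>X C. A ** C = C ** A \<Longrightarrow> trace (D X ** C) = real m * trace (mat_power A (m - 1) ** C ** X)"
    using mat_power_has_derivative by blast
  have "((\<lambda>B. trace (mat_power B m)) has_derivative (\<lambda>X. trace (D X))) (at A)"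
    by (rule bounded_linear.has_derivative[OF _ D])
      (simp add: linear_conv_bounded_linear[symmetric] linear_trace)
  then show ?thesis using tr[of "mat 1"] by simp
qed

text \<open>
  Used for the lines through a point of \<open>Q\<close>, and for the curves in the sphere that define its
  tangent space.
\<close>
lemma derivative_zero_if_constant_along_curve:
  assumes f: "(f has_derivative f') (at (\<gamma> 0))"
    and \<gamma>: "(\<gamma> has_vector_derivative X) (at (0::real))"
    and const: "\<And>t. f (\<gamma> t) = c"
  shows "f' X = 0"
proof -
  have "((f \<circ> \<gamma>) has_derivative (f' \<circ> (\<lambda>t. t *\<^sub>R X))) (at 0)"
    using diff_chain_at \<gamma> f unfolding has_vector_derivative_def by blast
  moreover have "f \<circ> \<gamma> = (\<lambda>_. c)" using const by auto
  ultimately have "f' \<circ> (\<lambda>t. t *\<^sub>R X) = (\<lambda>_. 0)"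
    using has_derivative_unique has_derivative_const by metis
  then show ?thesis by (metis comp_apply scaleR_one)
qed

text \<open>
  The polynomial \<open>tr (A + t X)\<^bsup>2k+1\<^esup>\<close> in \<open>t\<close> vanishes identically; this is its linear coefficient.
\<close>
lemma austere_subspace_tangent:
  fixes A X :: "real^'n^'n"
  assumes Q: "austere_subspace Q" and A: "A \<in> Q" and X: "X \<in> Q"
    and k: "k \<le> (CARD('n) - 1) div 2"
  shows "trace (mat_power A (2 * k) ** X) = 0"
proof -
  have line: "((\<lambda>t. A + t *\<^sub>R X) has_vector_derivative X) (at 0)"
    by (auto intro!: derivative_eq_intros)
  have "A + t *\<^sub>R X \<in> Q" for t
    using Q A X by (simp add: austere_subspace_def subspace_add subspace_scale)
  then have zero: "trace (mat_power (A + t *\<^sub>R X) (2 * k + 1)) = 0" for t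
    using Q k by (auto simp: austere_subspace_def austere_def)
  have "real (2 * k + 1) * trace (mat_power A (2 * k + 1 - 1) ** X) = 0"
  proof (rule derivative_zero_if_constant_along_curve[OF _ line])
    show "((\<lambda>B. trace (mat_power B (2 * k + 1))) has_derivative
      (\<lambda>X. real (2 * k + 1) * trace (mat_power A (2 * k + 1 - 1) ** X))) (at (A + 0 *\<^sub>R X))"
      using trace_mat_power_has_derivative[where m="2 * k + 1" and A=A] by simp
  qed (rule zero)
  then show ?thesis by simp
qed

text \<open>
  The quadratic coefficient of the polynomial \<open>tr (A + t X)\<^sup>3\<close>, which vanishes identically. The
  dimension must be at least three for the traces of cubes to be among those that austerity controls.
\<close>
lemma austere_subspace_quadratic:
  fixes A X :: "real^'n^'n"
  assumes Q: "austere_subspace Q" and A: "A \<in> Q" and X: "X \<in> Q" and n: "CARD('n) \<ge> 3"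
  shows "trace (A ** X ** X) = 0"
proof -
  have cube: "trace (Y ** Y ** Y) = 0" if "Y \<in> Q" for Y
  proof -
    have "1 \<le> (CARD('n) - 1) div 2" using n by simp
    then have "trace (mat_power Y (2 * 1 + 1)) = 0"
      using that Q unfolding austere_subspace_def austere_def by blast
    then show ?thesis
      by (simp add: matrix_mul_assoc numeral_3_eq_3)
  qed
  have sub: "subspace Q" using Q by (simp add: austere_subspace_def)
  have AXX: "trace (X ** A ** X) = trace (A ** X ** X)" "trace (X ** X ** A) = trace (A ** X ** X)"
    by (metis trace_mul_sym matrix_mul_assoc)+
  have AAX: "trace (A ** X ** A) = trace (A ** A ** X)" "trace (X ** A ** A) = trace (A ** A ** X)"
    by (metis trace_mul_sym matrix_mul_assoc)+
  have "trace ((A + X) ** (A + X) ** (A + X)) = 3 * trace (A ** A ** X) + 3 * trace (A ** X ** X)"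
    using AXX AAX cube[OF A] cube[OF X]
    by (simp add: matrix_add_ldistrib matrix_add_rdistrib trace_add)
  moreover have "trace (A ** A ** X) = 0"
  proof -
    have "1 \<le> (CARD('n) - 1) div 2" using n by simp
    from austere_subspace_tangent[OF Q A X this] show ?thesis by (simp add: numeral_2_eq_2)
  qed
  ultimately show ?thesis
    using cube[OF subspace_add[OF sub A X]] by simp
qed

text \<open>
  The \<open>k\<close>-th component of the differential at \<open>A\<close> is \<open>(2k + 1) tr (A\<^bsup>2k\<^esup> X)\<close>, so a linear relation
  between the functionals \<open>tr (A\<^bsup>2k\<^esup> X)\<close> would confine the image of the differential to a
  hyperplane. The functional with \<open>k = 0\<close> vanishes on the tangent space of the sphere, since the
  sphere consists of traceless matrices; its coefficient is found by inserting \<open>X = 1\<close>.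
\<close>
lemma regular_point_powers_independent:
  fixes A :: "real^'n^'n"
  defines "p \<equiv> (CARD('n) - 1) div 2"
  assumes reg: "regular_point A"
    and rel: "\<And>X. (\<Sum>k\<le>p. c k * trace (mat_power A (2 * k) ** X)) = 0"
    and k: "k \<le> p"
  shows "c k = 0"
proof -
  have pos: "c l = 0" if l: "l \<in> {1..p}" for l
  proof -
    \<comment> \<open>This value cancels the factor in the differential: \<open>tr (A\<^bsup>2l\<^esup> X)\<close> becomes one.\<close>
    define y where "y = (\<lambda>k\<in>{1..p}. if k = l then real (2 * l + 1) else 0)"
    have "y \<in> R_pow p" by (auto simp: y_def R_pow_def)
    also have "R_pow p = dPhi A ` tangent_space S_sphere A"
      using reg by (simp add: regular_point_def p_def)
    finally obtain X where dX: "y = dPhi A X" and X: "X \<in> tangent_space S_sphere A"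
      by (rule imageE)
    have tr: "trace (mat_power A (2 * k) ** X) = (if k = l then 1 else 0)" if k: "k \<in> {1..p}" for k
    proof -
      have "dPhi A X k = frechet_derivative (\<lambda>B. trace (mat_power B (2 * k + 1))) (at A) X"
        using k by (simp add: dPhi_def Phi_def p_def)
      also have "\<dots> = real (2 * k + 1) * trace (mat_power A (2 * k) ** X)"
        by (subst frechet_derivative_at[OF trace_mat_power_has_derivative, symmetric]) simp
      finally have "real (2 * k + 1) * trace (mat_power A (2 * k) ** X) = y k"
        using dX by simp
      then show ?thesis using k by (auto simp: y_def split: if_splits)
    qed
    have "trace X = 0"
    proof -
      obtain \<gamma> where \<gamma>: "range \<gamma> \<subseteq> S_sphere" "(\<gamma> has_vector_derivative X) (at 0)"
        using X unfolding tangent_space_def by blast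
      have "trace (\<gamma> t) = 0" for t
        using \<gamma>(1) by (auto simp: S_sphere_def E_space_def)
      moreover have "(trace has_derivative trace) (at (\<gamma> 0))"
        by (rule linear_imp_has_derivative[OF linear_trace])
      ultimately show ?thesis
        using derivative_zero_if_constant_along_curve[OF _ \<gamma>(2)] by blast
    qed
    moreover have "{..p} = insert 0 {1..p}" by auto
    ultimately have "(\<Sum>k\<in>{1..p}. c k * trace (mat_power A (2 * k) ** X)) = 0"
      using rel[of X] by simp
    also have "(\<Sum>k\<in>{1..p}. c k * trace (mat_power A (2 * k) ** X)) = (\<Sum>k\<in>{1..p}. if k = l then c k else 0)"
      by (intro sum.cong) (auto simp: tr)
    finally show ?thesis using l by simp
  qed
  moreover have "c 0 = 0"
  proof -
    have "{..p} = insert 0 {1..p}" by auto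
    then show ?thesis using rel[of "mat 1"] pos by (simp add: trace_I)
  qed
  ultimately show ?thesis using k by (cases "k = 0") auto
qed

section \<open>Orthogonal conjugation and diagonal matrices\<close>

lemma mat_power_orthogonal_conj:
  fixes A P :: "real^'n^'n"
  assumes "orthogonal_matrix P"
  shows "mat_power (transpose P ** A ** P) k = transpose P ** mat_power A k ** P"
proof (induction k)
  case 0
  then show ?case using assms by (simp add: orthogonal_matrix)
next
  case (Suc k)
  have PP: "P ** transpose P = mat 1" using assms by (simp add: orthogonal_matrix_def)
  have "mat_power (transpose P ** A ** P) (Suc k)
      = transpose P ** A ** (P ** transpose P) ** mat_power A k ** P"
    by (simp add: Suc matrix_mul_assoc)
  also have "\<dots> = transpose P ** mat_power A (Suc k) ** P"
    unfolding PP by (simp add: matrix_mul_assoc)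
  finally show ?case .
qed

lemma trace_orthogonal_conj:
  fixes A P :: "real^'n^'n"
  assumes "orthogonal_matrix P"
  shows "trace (transpose P ** A ** P) = trace A"
proof -
  have PP: "P ** transpose P = mat 1" using assms by (simp add: orthogonal_matrix_def)
  have "trace (transpose P ** A ** P) = trace (A ** P ** transpose P)"
    unfolding matrix_mul_assoc[symmetric] by (subst trace_mul_sym) (simp add: matrix_mul_assoc)
  also have "A ** P ** transpose P = A ** (P ** transpose P)" by (simp add: matrix_mul_assoc)
  finally show ?thesis unfolding PP by simp
qed

lemma austere_orthogonal_conj:
  fixes A P :: "real^'n^'n"
  assumes "orthogonal_matrix P" "austere A"
  shows "austere (transpose P ** A ** P)"
  using assms
  by (simp add: austere_def symmetric_mat_def mat_power_orthogonal_conj trace_orthogonal_conj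
      matrix_transpose_mul matrix_mul_assoc del: mat_power.simps)

lemma diagonal_mult_component:
  fixes X :: "real^'n^'n"
  shows "((\<chi> i j. if i = j then d i else 0) ** X) $ i $ j = d i * X $ i $ j"
proof -
  have "((\<chi> i j. if i = j then d i else 0) ** X) $ i $ j
      = (\<Sum>l\<in>UNIV. (if i = l then d i else 0) * X $ l $ j)"
    by (simp add: matrix_matrix_mult_def)
  also have "\<dots> = (\<Sum>l\<in>UNIV. if l = i then d i * X $ i $ j else 0)"
    by (intro sum.cong) auto
  finally show ?thesis by simp
qed

lemma mat_power_diagonal:
  fixes d :: "'n::finite \<Rightarrow> real"
  shows "mat_power (\<chi> i j. if i = j then d i else 0) k = (\<chi> i j. if i = j then d i ^ k else 0)"
  by (induction k) (simp_all add: mat_def vec_eq_iff diagonal_mult_component)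

lemma trace_diagonal_mult:
  fixes X :: "real^'n^'n"
  shows "trace ((\<chi> i j. if i = j then d i else 0) ** X) = (\<Sum>i\<in>UNIV. d i * X $ i $ i)"
  by (simp add: trace_def diagonal_mult_component)

section \<open>The squares of the eigenvalues\<close>

lemma sum_poly_mult_eq_0:
  fixes x y :: "'i \<Rightarrow> real"
  assumes "\<And>k. k \<le> p \<Longrightarrow> (\<Sum>i\<in>I. y i ^ k * x i) = 0" and "degree q \<le> p"
  shows "(\<Sum>i\<in>I. poly q (y i) * x i) = 0"
proof -
  have "(\<Sum>i\<in>I. poly q (y i) * x i) = (\<Sum>i\<in>I. \<Sum>k\<le>degree q. coeff q k * (y i ^ k * x i))"
    by (simp add: poly_altdef sum_distrib_right mult.assoc)
  also have "\<dots> = (\<Sum>k\<le>degree q. coeff q k * (\<Sum>i\<in>I. y i ^ k * x i))"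
    by (subst sum.swap) (simp add: sum_distrib_left)
  also have "\<dots> = 0" using assms by (intro sum.neutral) auto
  finally show ?thesis .
qed

lemma degree_prod_monic_linear:
  fixes S :: "real set"
  shows "degree (\<Prod>t\<in>S. [:- t, 1:]) = card S"
  by (cases "finite S") (simp_all add: degree_prod_sum_eq)

text \<open>
  As \<open>y\<close> has at most \<open>p + 1\<close> values, the polynomial that vanishes at all of them except \<open>s\<close> has
  degree at most \<open>p\<close>; it isolates the part of the sum where \<open>y\<close> is \<open>s\<close>.
\<close>
lemma fiber_sum_eq_0:
  fixes x y :: "'i \<Rightarrow> real"
  assumes I: "finite I" "card (y ` I) \<le> Suc p"
    and 0: "\<And>k. k \<le> p \<Longrightarrow> (\<Sum>i\<in>I. y i ^ k * x i) = 0" and s: "s \<in> y ` I"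
  shows "(\<Sum>i\<in>{i\<in>I. y i = s}. x i) = 0"
proof -
  define q where "q = (\<Prod>t\<in>y ` I - {s}. [:- t, 1:])"
  have deg: "degree q \<le> p"
    using I s by (simp add: q_def degree_prod_monic_linear)
  have qs: "poly q s \<noteq> 0" using I by (simp add: q_def poly_prod)
  have "poly q (y i) = (if y i = s then poly q s else 0)" if "i \<in> I" for i
    using that I(1) by (auto simp: q_def poly_prod)
  then have "(\<Sum>i\<in>I. poly q (y i) * x i) = (\<Sum>i\<in>I. if y i = s then poly q s * x i else 0)"
    by (intro sum.cong) auto
  also have "\<dots> = poly q s * (\<Sum>i\<in>{i\<in>I. y i = s}. x i)"
    using I(1) by (simp add: sum.inter_filter[symmetric] sum_distrib_left)
  finally show ?thesis using sum_poly_mult_eq_0[OF 0 deg] qs by simp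
qed

text \<open>
  By symmetry the number of indices over a nonzero square is even, hence at least two, and over zero
  if zero is a square, it is at least one. With at least \<open>p + 1\<close> squares and at most \<open>2p + 2\<close> indices there is room for
  neither a further square nor a third index over one of them.
\<close>
lemma symmetric_spectrum_fibers:
  fixes d :: "'n::finite \<Rightarrow> real"
  assumes sym: "\<And>x. x \<noteq> 0 \<Longrightarrow> card {i. d i = x} = card {i. d i = - x}"
    and n: "CARD('n) \<le> 2 * p + 2" and r: "p + 1 \<le> card (range (\<lambda>i. (d i)\<^sup>2))"
  shows "card (range (\<lambda>i. (d i)\<^sup>2)) = p + 1" and "card {i. (d i)\<^sup>2 = s} \<le> 2"
proof -
  define S where "S = range (\<lambda>i. (d i)\<^sup>2)"
  define F where "F s = card {i. (d i)\<^sup>2 = s}" for s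
  have finS: "finite S" by (simp add: S_def)
  have total: "CARD('n) = sum F S"
    using sum.group[of "UNIV :: 'n set" S "\<lambda>i. (d i)\<^sup>2" "\<lambda>_. 1::nat"]
    by (simp add: S_def F_def)
  have pos: "F s \<ge> 1" if "s \<in> S" for s
    using that by (auto simp: S_def F_def Suc_le_eq card_gt_0_iff)
  have even: "even (F s)" if "s \<in> S" "s \<noteq> 0" for s
  proof -
    obtain x where "s = x\<^sup>2" using \<open>s \<in> S\<close> by (auto simp: S_def)
    with that have x: "s = x\<^sup>2" "x \<noteq> 0" by auto
    have "{i. (d i)\<^sup>2 = s} = {i. d i = x} \<union> {i. d i = - x}"
      using x by (auto simp: power2_eq_iff)
    moreover have "{i. d i = x} \<inter> {i. d i = - x} = {}" using x by auto
    ultimately have "F s = card {i. d i = x} + card {i. d i = - x}"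
      by (simp add: F_def card_Un_disjoint)
    then show ?thesis using sym[OF x(2)] by simp
  qed
  have two: "2 \<le> F s" if "s \<in> S" "s \<noteq> 0" for s
    using pos[OF that(1)] even[OF that] by (metis One_nat_def Suc_1 Suc_leI le_neq_implies_less odd_one)
  \<comment> \<open>Every square has at least two indices, except that zero may have only one.\<close>
  have low: "2 * card T \<le> sum F T + (if 0 \<in> T then 1 else 0)" if "T \<subseteq> S" for T
  proof -
    have "finite T" using that finS finite_subset by blast
    then have "2 * card T = (\<Sum>s\<in>T. 2)" by simp
    also have "\<dots> \<le> (\<Sum>s\<in>T. F s + (if s = 0 then 1 else 0))"
      using that pos two by (intro sum_mono) fastforce
    also have "\<dots> = sum F T + (if 0 \<in> T then 1 else 0)"
      using \<open>finite T\<close> by (simp add: sum.distrib)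
    finally show ?thesis .
  qed
  have cardS: "card S = p + 1"
    using low[of S] total n r by (auto simp: S_def split: if_splits)
  then show "card (range (\<lambda>i. (d i)\<^sup>2)) = p + 1" by (simp add: S_def)
  have "F s \<le> 2"
  proof (cases "s \<in> S")
    case True
    have "CARD('n) = F s + sum F (S - {s})"
      using total sum.remove[OF finS True, of F] by simp
    moreover have "2 * p \<le> sum F (S - {s}) + (if 0 \<in> S - {s} then 1 else 0)"
      using low[of "S - {s}"] finS True cardS by auto
    moreover have "even (F s)" if "s \<noteq> 0" using even True that by blast
    ultimately show ?thesis using n
      by (cases "s = 0") (auto elim!: evenE split: if_splits)
  next
    case False
    then have "{i. (d i)\<^sup>2 = s} = {}" by (auto simp: S_def)
    then show ?thesis by (simp add: F_def)
  qed
  then show "card {i. (d i)\<^sup>2 = s} \<le> 2" by (simp add: F_def)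
qed

text \<open>
  If there were at most \<open>p\<close> different squares, then the monic polynomial with exactly these roots
  would have degree at most \<open>p\<close> and annihilate \<open>A\<^sup>2\<close>, contradicting the independence of the even
  powers at a regular point.
\<close>
lemma regular_point_card_squares:
  fixes A P :: "real^'n^'n" and d :: "'n \<Rightarrow> real"
  assumes reg: "regular_point A" and P: "orthogonal_matrix P"
    and D: "transpose P ** A ** P = (\<chi> i j. if i = j then d i else 0)"
  shows "(CARD('n) - 1) div 2 + 1 \<le> card (range (\<lambda>i. (d i)\<^sup>2))"
proof (rule ccontr)
  define p where "p = (CARD('n) - 1) div 2"
  define q where "q = (\<Prod>t\<in>range (\<lambda>i. (d i)\<^sup>2). [:- t, 1:])"
  assume "\<not> ?thesis"
  then have deg: "degree q \<le> p" by (simp add: q_def degree_prod_monic_linear p_def)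
  have root: "poly q ((d i)\<^sup>2) = 0" for i by (auto simp: q_def poly_prod)
  have tr: "trace (mat_power A (2 * k) ** X)
      = (\<Sum>i\<in>UNIV. ((d i)\<^sup>2) ^ k * (transpose P ** X ** P) $ i $ i)" for k X
  proof -
    have PP: "P ** transpose P = mat 1" using P by (simp add: orthogonal_matrix_def)
    have "trace (mat_power A (2 * k) ** X) = trace (transpose P ** (mat_power A (2 * k) ** X) ** P)"
      using trace_orthogonal_conj[OF P] by simp
    also have "transpose P ** (mat_power A (2 * k) ** X) ** P
        = transpose P ** (mat_power A (2 * k) ** (P ** transpose P) ** X) ** P"
      unfolding PP by simp
    also have "\<dots> = mat_power (transpose P ** A ** P) (2 * k) ** (transpose P ** X ** P)"
      unfolding mat_power_orthogonal_conj[OF P] by (simp add: matrix_mul_assoc)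
    finally show ?thesis
      by (simp add: D mat_power_diagonal trace_diagonal_mult power_mult)
  qed
  have coeffs: "(\<Sum>k\<le>p. coeff q k * x ^ k) = poly q x" for x
    unfolding poly_altdef using deg
    by (intro sum.mono_neutral_right) (auto simp: coeff_eq_0)
  have "(\<Sum>k\<le>p. coeff q k * trace (mat_power A (2 * k) ** X)) = 0" for X
  proof -
    have "(\<Sum>k\<le>p. coeff q k * trace (mat_power A (2 * k) ** X))
        = (\<Sum>i\<in>UNIV. (\<Sum>k\<le>p. coeff q k * ((d i)\<^sup>2) ^ k) * (transpose P ** X ** P) $ i $ i)"
      unfolding tr sum_distrib_left sum_distrib_right by (subst sum.swap) (simp add: mult.assoc)
    also have "\<dots> = (\<Sum>i\<in>UNIV. poly q ((d i)\<^sup>2) * (transpose P ** X ** P) $ i $ i)"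
      unfolding coeffs ..
    finally show ?thesis by (simp add: root)
  qed
  then have "coeff q (degree q) = 0"
    using regular_point_powers_independent[OF reg] deg unfolding p_def by blast
  then have "q = 0" by simp
  then show False by (simp add: q_def)
qed

section \<open>Counting determined entries\<close>

text \<open>
  Forgetting the entries outside \<open>C\<close> is an injective linear map on \<open>Q\<close>, with image in the span
  of the matrix units indexed by \<open>C\<close>.
\<close>
lemma dim_le_card_coordinates:
  fixes Q :: "(real^'n^'n) set" and C :: "('n \<times> 'n) set"
  assumes Q: "subspace Q"
    and C: "\<And>X. X \<in> Q \<Longrightarrow> (\<And>i j. (i, j) \<in> C \<Longrightarrow> X $ i $ j = 0) \<Longrightarrow> X = 0"
  shows "dim Q \<le> card C"
proof -
  define f :: "real^'n^'n \<Rightarrow> real^'n^'n" where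
    "f X = (\<Sum>(i, j)\<in>C. (X $ i $ j) *\<^sub>R axis i (axis j 1))" for X
  define e :: "'n \<times> 'n \<Rightarrow> real^'n^'n" where "e = (\<lambda>(i, j). axis i (axis j 1))"
  have lin: "linear f"
    by (intro linearI)
      (simp_all add: f_def scaleR_sum_right scaleR_add_left sum.distrib case_prod_unfold)
  have fC: "f X $ i $ j = X $ i $ j" if "(i, j) \<in> C" for X i j
  proof -
    have "f X $ i $ j = (\<Sum>ab\<in>C. if ab = (i, j) then X $ i $ j else 0)"
      unfolding f_def sum_component
      by (intro sum.cong) (auto simp: axis_def split: if_splits)
    then show ?thesis using that by simp
  qed
  have "inj_on f Q"
  proof (rule linear_inj_on_iff_eq_0[THEN iffD2, OF lin Q], safe)
    fix X assume "X \<in> Q" "f X = 0"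
    then show "X = 0" using C fC by (metis zero_index)
  qed
  then have "dim Q = dim (f ` Q)"
    using lin Q by (metis dim_image_eq span_eq_iff)
  also have "\<dots> \<le> card (e ` C)"
  proof (rule dim_le_card)
    show "f ` Q \<subseteq> span (e ` C)"
      by (fastforce simp: f_def e_def intro: span_sum span_scale span_base)
  qed simp
  also have "\<dots> \<le> card C" by (rule card_image_le) simp
  finally show ?thesis .
qed

lemma card_ordered_pairs:
  fixes g :: "'n::finite \<Rightarrow> nat"
  assumes "inj g"
  shows "2 * card {(i, j). g i < g j} + CARD('n) = CARD('n) * CARD('n)"
proof -
  let ?L = "{(i, j). g i < g j}"
  have "UNIV = ?L \<union> prod.swap ` ?L \<union> range (\<lambda>i. (i, i))"
    using assms by (auto simp: inj_def image_iff)
  moreover have "?L \<inter> prod.swap ` ?L = {}" "(?L \<union> prod.swap ` ?L) \<inter> range (\<lambda>i. (i, i)) = {}"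
    by auto
  moreover have "card (prod.swap ` ?L) = card ?L" by (simp add: card_image)
  moreover have "card (range (\<lambda>i::'n. (i, i))) = CARD('n)" by (simp add: card_image inj_def)
  ultimately have "card (UNIV :: ('n \<times> 'n) set) = card ?L + card ?L + CARD('n)"
    by (metis (no_types, lifting) card_Un_disjoint finite)
  then show ?thesis by (simp add: card_cartesian_product UNIV_Times_UNIV[symmetric] del: UNIV_Times_UNIV)
qed

text \<open>
  A matrix in \<open>Q\<close> is determined by fewer entries than a general symmetric matrix: one diagonal
  entry for each value of the squares is redundant, since the diagonal entries over that value sum to
  zero, and so are the entries in \<open>W\<close>, if \<open>det\<close> holds. The injection \<open>g\<close> orders the index type, so
  that \<open>L\<close> stands for the entries above the diagonal.
\<close>
lemma dim_le_of_determined_entries: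
  fixes Q :: "(real^'n^'n) set" and d :: "'n \<Rightarrow> real" and g :: "'n \<Rightarrow> nat"
  defines "L \<equiv> {(i, j). g i < g j}"
  assumes Q: "subspace Q" and sym: "\<And>X. X \<in> Q \<Longrightarrow> transpose X = X"
    and g: "inj g" and r: "card (range (\<lambda>i. (d i)\<^sup>2)) = p + 1"
    and diag: "\<And>X k. X \<in> Q \<Longrightarrow> k \<le> p \<Longrightarrow> (\<Sum>i\<in>UNIV. d i ^ (2 * k) * X $ i $ i) = 0"
    and W: "W \<subseteq> L"
    and det: "\<And>X i j. X \<in> Q \<Longrightarrow> (\<And>i. X $ i $ i = 0) \<Longrightarrow>
      (\<And>i j. (i, j) \<in> L - W \<Longrightarrow> X $ i $ j = 0) \<Longrightarrow> (i, j) \<in> W \<Longrightarrow> X $ i $ j = 0"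
  shows "dim Q + card W + (p + 1) \<le> card L + CARD('n)"
proof -
  \<comment> \<open>The first index over each square; its diagonal entry is the redundant one.\<close>
  define R where "R = {i. \<forall>j. (d j)\<^sup>2 = (d i)\<^sup>2 \<longrightarrow> g i \<le> g j}"
  have R1: "i = j" if "i \<in> R" "j \<in> R" "(d i)\<^sup>2 = (d j)\<^sup>2" for i j
  proof -
    have "g i \<le> g j" "g j \<le> g i" using that by (simp_all add: R_def)
    then show ?thesis using g by (simp add: inj_def)
  qed
  have "range (\<lambda>i. (d i)\<^sup>2) \<subseteq> (\<lambda>i. (d i)\<^sup>2) ` R"
  proof safe
    fix i
    obtain j where j: "(d j)\<^sup>2 = (d i)\<^sup>2" "\<And>k. (d k)\<^sup>2 = (d i)\<^sup>2 \<Longrightarrow> g j \<le> g k"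
      using ex_has_least_nat[of "\<lambda>j. (d j)\<^sup>2 = (d i)\<^sup>2" i g] by auto
    then have "j \<in> R" by (auto simp: R_def)
    then show "(d i)\<^sup>2 \<in> (\<lambda>i. (d i)\<^sup>2) ` R" using j(1) by (metis imageI)
  qed
  then have "card R = p + 1"
    using r R1 by (metis (mono_tags, lifting) card_image inj_onI image_mono subset_UNIV subset_antisym)
  define C where "C = (L - W) \<union> (\<lambda>i. (i, i)) ` (- R)"
  have "dim Q \<le> card C"
  proof (rule dim_le_card_coordinates[OF Q])
    fix X assume X: "X \<in> Q" and XC: "\<And>i j. (i, j) \<in> C \<Longrightarrow> X $ i $ j = 0"
    have nR: "X $ i $ i = 0" if "i \<notin> R" for i using that XC by (auto simp: C_def)
    have D: "X $ i $ i = 0" for i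
    proof (cases "i \<in> R")
      case True
      have "(\<Sum>j\<in>{j\<in>UNIV. (d j)\<^sup>2 = (d i)\<^sup>2}. X $ j $ j) = 0"
        by (rule fiber_sum_eq_0[where p=p]) (use r diag[OF X] in \<open>auto simp: power_mult\<close>)
      moreover have "(\<Sum>j\<in>{j\<in>UNIV. (d j)\<^sup>2 = (d i)\<^sup>2}. X $ j $ j)
          = (\<Sum>j\<in>{j\<in>UNIV. (d j)\<^sup>2 = (d i)\<^sup>2}. if j = i then X $ i $ i else 0)"
        using R1[OF _ True] nR by (intro sum.cong) auto
      ultimately show ?thesis by simp
    qed (rule nR)
    have "X $ i $ j = 0" if "(i, j) \<in> L" for i j
      using that det[OF X D, of i j] XC by (cases "(i, j) \<in> W") (auto simp: C_def)
    moreover have "X $ i $ j = X $ j $ i" for i j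
      using sym[OF X] by (metis transpose_def vec_lambda_beta)
    ultimately have "X $ i $ j = 0" for i j
      using D g unfolding L_def inj_def by (metis (mono_tags, lifting) case_prodI linorder_neqE_nat mem_Collect_eq)
    then show "X = 0" by (simp add: vec_eq_iff)
  qed
  also have "\<dots> \<le> card (L - W) + card ((\<lambda>i. (i, i)) ` (- R))"
    unfolding C_def by (rule card_Un_le)
  also have "\<dots> \<le> card (L - W) + card (- R)"
    by (intro add_left_mono card_image_le) simp
  finally have "dim Q \<le> card (L - W) + card (- R)" .
  moreover have "card (L - W) + card W = card L"
    using W by (simp add: card_Diff_subset card_mono)
  moreover have "card (- R) + (p + 1) = CARD('n)"
    using card_Un_disjoint[of "- R" R] \<open>card R = p + 1\<close> by (simp add: Compl_partition2)
  ultimately show ?thesis by linarith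
qed

text \<open>
  If each square has at most two indices, then a pair of opposite values is determined by its second
  index, and this index is not the first one over its square. So the second indices avoid a system of
  representatives for the squares.
\<close>
lemma card_opposite_pairs_le:
  fixes d :: "'n::finite \<Rightarrow> real" and g :: "'n \<Rightarrow> nat"
  assumes fib: "\<And>s. card {i. (d i)\<^sup>2 = s} \<le> 2"
  shows "card {(i, j). g i < g j \<and> d i + d j = 0} + card (range (\<lambda>i. (d i)\<^sup>2)) \<le> CARD('n)"
proof -
  define Z where "Z = {(i, j). g i < g j \<and> d i + d j = 0}"
  have sq: "(d i)\<^sup>2 = (d j)\<^sup>2" "i \<noteq> j" if "(i, j) \<in> Z" for i j
    using that by (auto simp: Z_def add_eq_0_iff2)
  have "inj_on snd Z"
  proof (intro inj_onI, clarsimp)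
    fix i i' j assume Z: "(i, j) \<in> Z" "(i', j) \<in> Z"
    show "i = i'"
    proof (rule ccontr)
      assume "i \<noteq> i'"
      then have "card {i, i', j} = 3" using sq(2)[OF Z(1)] sq(2)[OF Z(2)] by simp
      moreover have "card {i, i', j} \<le> card {k. (d k)\<^sup>2 = (d j)\<^sup>2}"
        using sq(1)[OF Z(1)] sq(1)[OF Z(2)] by (intro card_mono) auto
      ultimately show False using fib[of "(d j)\<^sup>2"] by simp
    qed
  qed
  then have "card (snd ` Z) = card Z" by (rule card_image)
  moreover have "range (\<lambda>i. (d i)\<^sup>2) \<subseteq> (\<lambda>i. (d i)\<^sup>2) ` (- snd ` Z)"
  proof safe
    fix i
    obtain j where j: "(d j)\<^sup>2 = (d i)\<^sup>2" "\<And>k. (d k)\<^sup>2 = (d i)\<^sup>2 \<Longrightarrow> g j \<le> g k"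
      using ex_has_least_nat[of "\<lambda>j. (d j)\<^sup>2 = (d i)\<^sup>2" i g] by auto
    have "j \<notin> snd ` Z"
    proof
      assume "j \<in> snd ` Z"
      then obtain k where k: "(k, j) \<in> Z" by auto
      then have "g j \<le> g k" using sq(1) j by metis
      with k show False by (simp add: Z_def)
    qed
    then show "(d i)\<^sup>2 \<in> (\<lambda>i. (d i)\<^sup>2) ` (- snd ` Z)" using j(1) by (metis ComplI imageI)
  qed
  then have "card (range (\<lambda>i. (d i)\<^sup>2)) \<le> card (- snd ` Z)"
    by (intro surj_card_le) auto
  moreover have "card (- snd ` Z) + card (snd ` Z) = CARD('n)"
    using card_Un_disjoint[of "- snd ` Z" "snd ` Z"] by (simp add: Compl_partition2)
  ultimately show ?thesis by (simp add: Z_def)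
qed

text \<open>
  Symmetrised, the form \<open>tr (D X\<^sup>2)\<close> is half the sum of the \<open>(d\<^sub>i + d\<^sub>j) X\<^sub>i\<^sub>j\<^sup>2\<close>. If its weights have the
  same sign wherever \<open>X\<close> has a nonzero entry, then all terms of the vanishing sum are zero.
\<close>
lemma entries_vanish_where_form_definite:
  fixes X :: "real^'n^'n"
  assumes sym: "transpose X = X"
    and quad: "(\<Sum>i\<in>UNIV. \<Sum>j\<in>UNIV. d i * (X $ i $ j)\<^sup>2) = 0"
    and nonneg: "\<And>i j. X $ i $ j \<noteq> 0 \<Longrightarrow> s * (d i + d j) \<ge> 0"
    and ij: "s * (d i + d j) \<noteq> 0"
  shows "X $ i $ j = 0"
proof -
  have X: "X $ i $ j = X $ j $ i" for i j
    using sym by (metis transpose_def vec_lambda_beta)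
  have "(\<Sum>i\<in>UNIV. \<Sum>j\<in>UNIV. d j * (X $ i $ j)\<^sup>2) = 0"
    using quad by (subst sum.swap, subst X) simp
  with quad have "(\<Sum>i\<in>UNIV. \<Sum>j\<in>UNIV. s * (d i + d j) * (X $ i $ j)\<^sup>2) = 0"
    by (simp add: distrib_right mult.assoc sum.distrib flip: sum_distrib_left)
  then have "(\<Sum>(i, j)\<in>UNIV. s * (d i + d j) * (X $ i $ j)\<^sup>2) = 0"
    by (simp add: sum.cartesian_product)
  moreover have "0 \<le> s * (d i + d j) * (X $ i $ j)\<^sup>2" for i j
    using nonneg[of i j] by (cases "X $ i $ j = 0") auto
  ultimately have "s * (d i + d j) * (X $ i $ j)\<^sup>2 = 0"
    by (subst (asm) sum_nonneg_eq_0_iff) auto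
  then show ?thesis using ij by simp
qed

text \<open>
  The entries above the diagonal split into those with \<open>d\<^sub>i + d\<^sub>j\<close> positive, negative and zero. A
  matrix in \<open>Q\<close> that has its nonzero entries only at positive places is isotropic for a definite form
  and vanishes, so all positive entries are redundant; likewise all negative ones. Averaging the two
  resulting bounds, and using that there are at most \<open>n - (p + 1)\<close> places with \<open>d\<^sub>i + d\<^sub>j = 0\<close>,
  gives \<open>2 dim Q + 3 (p + 1) \<le> n (n - 1) / 2 + 3 n\<close>, which is stated after doubling.
\<close>
lemma dim_bound_diagonal:
  fixes Q :: "(real^'n^'n) set" and d :: "'n \<Rightarrow> real"
  assumes Q: "subspace Q" and sym: "\<And>X. X \<in> Q \<Longrightarrow> transpose X = X"
    and n: "CARD('n) \<le> 2 * p + 2"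
    and r: "card (range (\<lambda>i. (d i)\<^sup>2)) = p + 1" and fib: "\<And>s. card {i. (d i)\<^sup>2 = s} \<le> 2"
    and diag: "\<And>X k. X \<in> Q \<Longrightarrow> k \<le> p \<Longrightarrow> (\<Sum>i\<in>UNIV. d i ^ (2 * k) * X $ i $ i) = 0"
    and quad: "\<And>X. X \<in> Q \<Longrightarrow> p \<ge> 1 \<Longrightarrow> (\<Sum>i\<in>UNIV. \<Sum>j\<in>UNIV. d i * (X $ i $ j)\<^sup>2) = 0"
  shows "4 * dim Q + 6 * (p + 1) \<le> CARD('n) * CARD('n) + 5 * CARD('n)"
proof -
  obtain g :: "'n \<Rightarrow> nat" where g: "inj g"
    using ex_bij_betw_finite_nat[of "UNIV :: 'n set"] by (auto simp: bij_betw_def)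
  define L where "L = {(i, j). g i < g j}"
  have L: "2 * card L + CARD('n) = CARD('n) * CARD('n)"
    using card_ordered_pairs[OF g] by (simp add: L_def)
  show ?thesis
  proof (cases "p = 0")
    case True
    \<comment> \<open>The matrices have at most two rows; the linear condition on the diagonal suffices.\<close>
    have "dim Q + card ({} :: ('n \<times> 'n) set) + (p + 1) \<le> card L + CARD('n)"
      unfolding L_def by (rule dim_le_of_determined_entries[OF Q sym g r diag]) auto
    moreover have "CARD('n) = 1 \<or> CARD('n) = 2"
      using n True zero_less_card_finite[where 'a='n] by linarith
    ultimately show ?thesis using L True by auto
  next
    case False
    \<comment> \<open>The redundant places: those of positive sum for \<open>s = 1\<close>, of negative sum for \<open>s = - 1\<close>.\<close>
    define W where "W s = {(i, j). g i < g j \<and> 0 < s * (d i + d j)}" for s :: real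
    define Z where "Z = {(i, j). g i < g j \<and> d i + d j = 0}"
    have bound: "dim Q + card (W s) + (p + 1) \<le> card L + CARD('n)" for s
      unfolding L_def
    proof (rule dim_le_of_determined_entries[OF Q sym g r diag])
      show "W s \<subseteq> {(i, j). g i < g j}" by (auto simp: W_def)
      fix X i j
      assume X: "X \<in> Q" and D: "\<And>i. X $ i $ i = 0"
        and off: "\<And>i j. (i, j) \<in> {(i, j). g i < g j} - W s \<Longrightarrow> X $ i $ j = 0"
        and ij: "(i, j) \<in> W s"
      have Xs: "X $ k $ l = X $ l $ k" for k l
        using sym[OF X] by (metis transpose_def vec_lambda_beta)
      show "X $ i $ j = 0"
      proof (rule entries_vanish_where_form_definite[OF sym[OF X] quad[OF X]])
        fix k l assume nz: "X $ k $ l \<noteq> 0"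
        then have "k \<noteq> l" using D by auto
        then consider "g k < g l" | "g l < g k" using g by (metis injD linorder_neqE_nat)
        then show "0 \<le> s * (d k + d l)"
        proof cases
          case 1
          then have "(k, l) \<in> W s" using off nz by blast
          then show ?thesis by (simp add: W_def)
        next
          case 2
          moreover have "X $ l $ k \<noteq> 0" using nz by (simp add: Xs[of l k])
          ultimately have "(l, k) \<in> W s" using off by blast
          then show ?thesis by (simp add: W_def add.commute)
        qed
      qed (use False ij in \<open>auto simp: W_def\<close>)
    qed
    have "card L = card (W 1) + card (W (- 1)) + card Z"
    proof -
      have "L = W 1 \<union> W (- 1) \<union> Z" by (auto simp: L_def W_def Z_def)
      moreover have "W 1 \<inter> W (- 1) = {}" "(W 1 \<union> W (- 1)) \<inter> Z = {}"
        by (auto simp: W_def Z_def)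
      ultimately show ?thesis by (simp add: card_Un_disjoint)
    qed
    moreover have "card Z + (p + 1) \<le> CARD('n)"
      using card_opposite_pairs_le[OF fib, of g] r by (simp add: Z_def)
    ultimately have "2 * (2 * dim Q + 3 * (p + 1)) \<le> 2 * (card L + 3 * CARD('n))"
      using bound[of 1] bound[of "- 1"] by simp
    also have "\<dots> = CARD('n) * CARD('n) + 5 * CARD('n)" using L by simp
    finally show ?thesis by simp
  qed
qed

section \<open>Dimension of austere subspaces through a regular point\<close>

theorem theorem6p4:
  fixes Q :: "(real^'n^'n) set" and n p :: nat
  assumes "n = CARD('n)" and "n \<ge> 2" and "p = (n - 1) div 2"
    and "austere_subspace Q"
    and "Q \<inter> B_set \<noteq> {}"
  shows "(n = 2 * p + 1 \<longrightarrow> dim Q \<le> p^2 + 2 * p) \<and>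
         (n = 2 * p + 2 \<longrightarrow> dim Q \<le> p^2 + 3 * p + 2)"
proof -
  note n = assms(1) and p = assms(3) and Q = assms(4)
  obtain A where A: "A \<in> Q" "regular_point A" using assms(5) by (auto simp: B_set_def)
  have "transpose A = A"
    using A(1) Q by (auto simp: austere_subspace_def austere_def symmetric_mat_def)
  then obtain P d where P: "orthogonal_matrix P"
    and D: "transpose P ** A ** P = (\<chi> i j. if i = j then d i else 0)"
    by (rule symmetric_matrix_diagonalization)
  \<comment> \<open>Conjugation by \<open>P\<close> preserves dimension and austerity and moves \<open>A\<close> to a diagonal matrix.\<close>
  define T where "T X = transpose P ** X ** P" for X :: "real^'n^'n"
  have lin: "linear T"
    unfolding T_def
    by (intro linearI)
      (simp_all add: matrix_add_ldistrib matrix_add_rdistrib matrix_scalar_ac scalar_matrix_assoc)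
  have PP: "P ** transpose P = mat 1" using P by (simp add: orthogonal_matrix_def)
  have "X = (P ** transpose P) ** X ** (P ** transpose P)" for X unfolding PP by simp
  then have inv: "X = P ** T X ** transpose P" for X
    by (simp add: T_def matrix_mul_assoc)
  then have "inj T" by (metis injI)
  then have dimT: "dim (T ` Q) = dim Q"
    using lin by (intro dim_image_eq) (auto intro: inj_on_subset)
  have TQ: "austere_subspace (T ` Q)"
    using Q linear_subspace_image[OF lin] austere_orthogonal_conj[OF P]
    unfolding austere_subspace_def by (auto simp: T_def[abs_def])
  have TA: "(\<chi> i j. if i = j then d i else 0) \<in> T ` Q"
    using A(1) D by (metis T_def imageI)
  have np: "n \<le> 2 * p + 2" using p by linarith
  have "card {i. d i = x} = card {i. d i = - x}" if x: "x \<noteq> 0" for x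
  proof -
    have "card {i\<in>UNIV. d i = x} = card {i\<in>UNIV. d i = - x}"
    proof (rule odd_power_sums_zero_imp_symmetric[OF finite _ x])
      fix k assume k: "odd k" "k \<le> CARD('n)"
      then obtain l where l: "k = 2 * l + 1" by (blast elim: oddE)
      then have "trace (mat_power (\<chi> i j. if i = j then d i else 0 :: real^'n^'n) k) = 0"
        using TQ TA k(2) by (auto simp: austere_subspace_def austere_def simp del: mat_power.simps)
      then show "(\<Sum>i\<in>UNIV. d i ^ k) = 0" by (simp add: mat_power_diagonal trace_def)
    qed
    then show ?thesis by simp
  qed
  note fibers = symmetric_spectrum_fibers[OF this np[unfolded n]
      regular_point_card_squares[OF A(2) P D, folded n, folded p]]
  have "4 * dim (T ` Q) + 6 * (p + 1) \<le> CARD('n) * CARD('n) + 5 * CARD('n)"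
  proof (rule dim_bound_diagonal[OF _ _ np[unfolded n] fibers])
    show "subspace (T ` Q)" using TQ by (simp add: austere_subspace_def)
    fix X assume X: "X \<in> T ` Q"
    show Xsym: "transpose X = X"
      using X TQ by (auto simp: austere_subspace_def austere_def symmetric_mat_def)
    show "(\<Sum>i\<in>UNIV. d i ^ (2 * k) * X $ i $ i) = 0" if "k \<le> p" for k
      using austere_subspace_tangent[OF TQ TA X, of k] that n p
      by (simp add: mat_power_diagonal trace_diagonal_mult)
    show "(\<Sum>i\<in>UNIV. \<Sum>j\<in>UNIV. d i * (X $ i $ j)\<^sup>2) = 0" if "p \<ge> 1"
    proof -
      have "CARD('n) \<ge> 3" using that n p by linarith
      from austere_subspace_quadratic[OF TQ TA X this]
      have "(\<Sum>i\<in>UNIV. d i * (X ** X) $ i $ i) = 0"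
        by (simp add: matrix_mul_assoc[symmetric] trace_diagonal_mult)
      moreover have "X $ i $ j = X $ j $ i" for i j
        using Xsym by (metis transpose_def vec_lambda_beta)
      then have "(X ** X) $ i $ i = (\<Sum>j\<in>UNIV. (X $ i $ j)\<^sup>2)" for i
        by (simp add: matrix_matrix_mult_def power2_eq_square)
      ultimately show ?thesis by (simp add: sum_distrib_left)
    qed
  qed
  then have main: "4 * dim Q + 6 * (p + 1) \<le> n * n + 5 * n" by (simp add: dimT n)
  show ?thesis
  proof (intro conjI impI)
    assume "n = 2 * p + 1"
    then show "dim Q \<le> p^2 + 2 * p" using main by (simp add: algebra_simps power2_eq_square)
  next
    assume "n = 2 * p + 2"
    then show "dim Q \<le> p^2 + 3 * p + 2" using main by (simp add: algebra_simps power2_eq_square)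
  qed
qed

end
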